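(* Let $\mathfrak A$ be a finite-dimensional associative algebra over $\mathbb C$ and $F$ a linear functional on it. Suppose that the restriction of the form $Q_F$ to the space $\mathrm{Stab}_F(1)$ is a non-degenerate symmetric form. Then $F$ is of type 1.
   Context: $Q_F$ is the symmetric bilinear form $Q_F(a,b)=F(ab+ba)$ on $\mathfrak A$, and $\mathrm{Stab}_F(1)=\{a\in\mathfrak A: F(ax)=F(xa)\text{ for all }x\in\mathfrak A\}$. $A_F$ denotes the matrix $(F(e_ie_j))_{i,j}$ in a basis $\{e_i\}$ of $\mathfrak A$. $F$ (or the pair $(\mathfrak A,F)$) is of type 1 if the characteristic polynomial $\chi_F(\lambda,\mu)=\det(\lambda A_F+\mu A_F^T)$ is not the zero polynomial in $\lambda,\mu$. *)

theory Defs
  imports Complex_Main "HOL-Computational_Algebra.Polynomial"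
    "Jordan_Normal_Form.Determinant"
begin

text \<open>The class \<open>ring\<close> requires associativity of the multiplication but no unit;
  algebras are not assumed to be unital or commutative.\<close>

locale fin_dim_complex_algebra = vector_space scale
  for scale :: "complex \<Rightarrow> 'a::ring \<Rightarrow> 'a" +
  assumes scale_mult_left: "scale c x * y = scale c (x * y)"
    and scale_mult_right: "x * scale c y = scale c (x * y)"
    and finite_dimensional: "\<exists>B. finite B \<and> module.span scale B = UNIV"

definition ordered_basis :: "(complex \<Rightarrow> 'a::ring \<Rightarrow> 'a) \<Rightarrow> 'a list \<Rightarrow> bool" where
  "ordered_basis scale es \<longleftrightarrow>
     distinct es \<and> \<not> module.dependent scale (set es) \<and> module.span scale (set es) = UNIV"

definition Q_form :: "('a::ring \<Rightarrow> complex) \<Rightarrow> 'a \<Rightarrow> 'a \<Rightarrow> complex" where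
  "Q_form F a b = F (a * b + b * a)"

definition Stab_one :: "('a::ring \<Rightarrow> complex) \<Rightarrow> 'a set" where
  "Stab_one F = {a. \<forall>x. F (a * x) = F (x * a)}"

text \<open>The left kernel suffices, as this is only used for symmetric forms.\<close>

definition nondegenerate_on :: "'a::zero set \<Rightarrow> ('a \<Rightarrow> 'a \<Rightarrow> complex) \<Rightarrow> bool" where
  "nondegenerate_on S Q \<longleftrightarrow> (\<forall>a\<in>S. (\<forall>b\<in>S. Q a b = 0) \<longrightarrow> a = 0)"

definition gram_matrix :: "('a::ring \<Rightarrow> complex) \<Rightarrow> 'a list \<Rightarrow> complex mat" where
  "gram_matrix F es = mat (length es) (length es) (\<lambda>(i, j). F (es ! i * es ! j))"

text \<open>The ring \<open>\<complex>[\<lambda>, \<mu>]\<close> is represented as \<open>\<complex>[\<lambda>][\<mu>]\<close>, so that \<open>\<lambda>\<close> is \<open>[:[:0, 1:]:]\<close>,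
  \<open>\<mu>\<close> is \<open>[:0, 1:]\<close>, and a scalar \<open>c\<close> is \<open>[:[:c:]:]\<close>.\<close>

definition char_poly2 :: "('a::ring \<Rightarrow> complex) \<Rightarrow> 'a list \<Rightarrow> complex poly poly" where
  "char_poly2 F es =
     (let A = map_mat (\<lambda>c. [:[:c:]:]) (gram_matrix F es)
      in det ([:[:0, 1:]:] \<cdot>\<^sub>m A + [:0, 1:] \<cdot>\<^sub>m transpose_mat A))"

text \<open>Changing the basis multiplies the characteristic polynomial by the nonzero square
  of a determinant. The quantification over bases is not vacuous, by the lemma
  \<open>ex_ordered_basis\<close> below.\<close>

definition type_one :: "(complex \<Rightarrow> 'a::ring \<Rightarrow> 'a) \<Rightarrow> ('a \<Rightarrow> complex) \<Rightarrow> bool" where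
  "type_one scale F \<longleftrightarrow> (\<forall>es. ordered_basis scale es \<longrightarrow> char_poly2 F es \<noteq> 0)"

lemma (in fin_dim_complex_algebra) ex_ordered_basis: "\<exists>es. ordered_basis scale es"
proof -
  obtain B where B: "finite B" "span B = UNIV"
    using finite_dimensional by blast
  obtain C where C: "C \<subseteq> B" "independent C" "B \<subseteq> span C"
    using maximal_independent_subset by blast
  have "span C = UNIV"
    using B(2) C(3) span_minimal[OF C(3) subspace_span] by auto
  moreover obtain es where "set es = C" "distinct es"
    using finite_distinct_list finite_subset[OF C(1) B(1)] by blast
  ultimately show ?thesis
    using C(2) by (auto simp: ordered_basis_def)
qed

lemma Q_form_commute: "Q_form F a b = Q_form F b a"
  by (simp add: Q_form_def add.commute)

end

theory Submission imports Defs begin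

text \<open>The statement is one of linear algebra: of the multiplication only the bilinear form
  \<open>(x, y) \<mapsto> F (x * y)\<close> matters. Let \<open>A\<close> be its Gram matrix and \<open>D = A - A\<^sup>T\<close>; then
  \<open>Stab_one F\<close> is the kernel of \<open>D\<close>.

  Suppose that the characteristic polynomial is zero. Setting \<open>\<mu> = -1\<close>, the matrix
  \<open>\<lambda> A - A\<^sup>T\<close> over \<open>\<complex>[\<lambda>]\<close> is singular, so it kills a nonzero vector \<open>v\<close> of polynomials.
  Dividing \<open>v\<close> by a power of \<open>\<lambda> - 1\<close>, one may assume that \<open>v\<^sub>0 = v(1)\<close> is not zero
  (\<open>poly_kernel_vector_nonzero_at\<close>). The value and the derivative of
  \<open>(\<lambda> A - A\<^sup>T) v(\<lambda>) = 0\<close> at \<open>\<lambda> = 1\<close> are \<open>D v\<^sub>0 = 0\<close> and \<open>A v\<^sub>0 + D v\<^sub>1 = 0\<close>, where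
  \<open>v\<^sub>1 = v'(1)\<close>. The first equation puts \<open>v\<^sub>0\<close> into \<open>Stab_one F\<close>. Pairing the second one with an
  arbitrary \<open>s\<close> in \<open>Stab_one F\<close> makes the term with \<open>D\<close> vanish, by antisymmetry of \<open>D\<close>, and
  leaves \<open>F (s * v\<^sub>0) = 0\<close>. So \<open>v\<^sub>0\<close> is a nonzero vector in the radical of the restricted form
  (\<open>first_order_deformation_zero\<close>).\<close>

text \<open>The relations are homogeneous in \<open>v\<close> and \<open>'a poly\<close> has no zero divisors, so a factor
  \<open>[:-c, 1:]\<close> common to all entries can be cancelled; each cancellation lowers the degree of a
  fixed nonzero entry, hence only finitely many are possible.\<close>

lemma poly_kernel_vector_nonzero_at:
  fixes v :: "'j \<Rightarrow> 'a::idom poly" and M :: "'i \<Rightarrow> 'j \<Rightarrow> 'a poly"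
  assumes "k \<in> J" and "v k \<noteq> 0"
    and "\<And>i. i \<in> I \<Longrightarrow> (\<Sum>j\<in>J. M i j * v j) = 0"
  obtains w where "\<And>i. i \<in> I \<Longrightarrow> (\<Sum>j\<in>J. M i j * w j) = 0"
    and "\<exists>j\<in>J. poly (w j) c \<noteq> 0"
  using assms
proof (induction "degree (v k)" arbitrary: v thesis rule: less_induct)
  case less
  show ?case
  proof (cases "\<exists>j\<in>J. poly (v j) c \<noteq> 0")
    case True
    then show ?thesis using less.prems by blast
  next
    case False
    then have "\<forall>j\<in>J. \<exists>q. v j = [:-c, 1:] * q"
      by (metis poly_eq_0_iff_dvd dvd_def)
    then obtain w where w: "\<And>j. j \<in> J \<Longrightarrow> v j = [:-c, 1:] * w j"
      by metis
    have wk: "w k \<noteq> 0"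
      using w[OF less.prems(2)] less.prems(3) by auto
    have "degree (v k) = Suc (degree (w k))"
      unfolding w[OF less.prems(2)] using wk by (subst degree_mult_eq) auto
    moreover have "(\<Sum>j\<in>J. M i j * w j) = 0" if "i \<in> I" for i
    proof -
      have "[:-c, 1:] * (\<Sum>j\<in>J. M i j * w j) = (\<Sum>j\<in>J. M i j * v j)"
        unfolding sum_distrib_left by (intro sum.cong refl) (simp only: w mult.left_commute)
      then show ?thesis using less.prems(4)[OF that] by (metis mult_eq_0_iff pCons_eq_0_iff one_neq_zero)
    qed
    ultimately show ?thesis
      using less.hyps[of w] less.prems(1,2) wk by auto
  qed
qed

text \<open>The hypotheses are the equations \<open>D v\<^sub>0 = 0\<close> and \<open>A v\<^sub>0 + D v\<^sub>1 = 0\<close> without coordinates: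
  for the pencil \<open>\<lambda> A - A\<^sup>T\<close>, the vector \<open>a\<close> of the kernel at \<open>\<lambda> = 1\<close> extends to first order,
  with derivative \<open>b\<close>. For \<open>x\<close> in \<open>Stab_one F\<close> the terms with \<open>b\<close> cancel.\<close>

lemma first_order_deformation_zero:
  fixes F :: "'a::ring \<Rightarrow> complex"
  assumes add: "\<And>x y. F (x + y) = F x + F y"
    and "nondegenerate_on (Stab_one F) (Q_form F)"
    and stab: "\<And>x. F (x * a) = F (a * x)"
    and def1: "\<And>x. F (x * a) + F (x * b) - F (b * x) = 0"
  shows "a = 0"
proof -
  have "a \<in> Stab_one F"
    by (simp add: Stab_one_def stab)
  moreover have "Q_form F a s = 0" if "s \<in> Stab_one F" for s
    using that def1[of s] stab[of s] by (simp add: Q_form_def Stab_one_def add)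
  ultimately show ?thesis
    using assms(2) by (auto simp: nondegenerate_on_def)
qed

text \<open>The pencil \<open>\<lambda> A - A\<^sup>T\<close> is reached by the evaluation \<open>\<mu> = -1\<close>, a ring homomorphism
  \<open>\<complex>[\<lambda>][\<mu>] \<rightarrow> \<complex>[\<lambda>]\<close>, which commutes with the determinant.\<close>

lemma char_poly2_zero_imp_kernel_vector:
  fixes F :: "'a::ring \<Rightarrow> complex"
  assumes "char_poly2 F es = 0"
  obtains v k where "k < length es" and "v k \<noteq> (0::complex poly)"
    and "\<And>i. i < length es \<Longrightarrow>
      (\<Sum>j<length es. [:- F (es ! j * es ! i), F (es ! i * es ! j):] * v j) = 0"
proof -
  let ?n = "length es"
  let ?ev = "\<lambda>p::complex poly poly. poly p (-1)"
  define P where "P = (let A = map_mat (\<lambda>c. [:[:c:]:]) (gram_matrix F es)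
      in [:[:0, 1:]:] \<cdot>\<^sub>m A + [:0, 1:] \<cdot>\<^sub>m transpose_mat A)"
  define N where "N = map_mat ?ev P"
  interpret ev: comm_ring_hom ?ev
    by unfold_locales auto
  have N: "N \<in> carrier_mat ?n ?n"
    by (simp add: N_def P_def gram_matrix_def Let_def)
  have entry: "N $$ (i, j) = [:- F (es ! j * es ! i), F (es ! i * es ! j):]"
    if "i < ?n" "j < ?n" for i j
    using that by (simp add: N_def P_def gram_matrix_def Let_def)
  have "det P = 0"
    using assms by (simp add: P_def char_poly2_def Let_def)
  then have "det N = 0"
    unfolding N_def by simp
  then obtain u where u: "u \<in> carrier_vec ?n" "u \<noteq> 0\<^sub>v ?n" "N *\<^sub>v u = 0\<^sub>v ?n"
    using det_0_iff_vec_prod_zero[OF N] by blast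
  obtain k where k: "k < ?n" "u $ k \<noteq> 0"
    using u(1,2) by (metis carrier_vecD eq_vecI index_zero_vec)
  have "(\<Sum>j<?n. [:- F (es ! j * es ! i), F (es ! i * es ! j):] * u $ j) = 0" if i: "i < ?n" for i
  proof -
    have "(\<Sum>j<?n. [:- F (es ! j * es ! i), F (es ! i * es ! j):] * u $ j) = (\<Sum>j<?n. N $$ (i, j) * u $ j)"
      using entry i by (intro sum.cong) auto
    also have "\<dots> = (N *\<^sub>v u) $ i"
      using i N u(1) by (auto simp: scalar_prod_def atLeast0LessThan intro!: sum.cong)
    finally show ?thesis using u(3) i by simp
  qed
  with k show ?thesis by (rule that)
qed

theorem theorem14:
  fixes scale :: "complex \<Rightarrow> 'a::ring \<Rightarrow> 'a"
    and F :: "'a \<Rightarrow> complex"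
  assumes "fin_dim_complex_algebra scale"
    and "Vector_Spaces.linear scale (*) F"
    and "nondegenerate_on (Stab_one F) (Q_form F)"
  shows "type_one scale F"
  unfolding type_one_def
proof (intro allI impI notI)
  fix es
  assume basis: "ordered_basis scale es" and zero: "char_poly2 F es = 0"
  interpret fin_dim_complex_algebra scale by fact
  interpret F: Vector_Spaces.linear scale "(*)" F by fact
  let ?n = "length es"
  let ?M = "\<lambda>i j. [:- F (es ! j * es ! i), F (es ! i * es ! j):]"
  obtain v k where "k < ?n" "v k \<noteq> 0" "\<And>i. i < ?n \<Longrightarrow> (\<Sum>j<?n. ?M i j * v j) = 0"
    using char_poly2_zero_imp_kernel_vector[OF zero] by blast
  then obtain w where w: "\<And>i. i < ?n \<Longrightarrow> (\<Sum>j<?n. ?M i j * w j) = 0"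
    and nz: "\<exists>j\<in>{..<?n}. poly (w j) 1 \<noteq> 0"
    using poly_kernel_vector_nonzero_at[of k "{..<?n}" v "{..<?n}" ?M 1]
    unfolding lessThan_iff by blast
  define lc where "lc u = (\<Sum>j<?n. scale (u j) (es ! j))" for u
  \<comment> \<open>\<open>a\<close> and \<open>b\<close> are the elements with coordinates \<open>v\<^sub>0\<close> and \<open>v\<^sub>1\<close>, the first-order Taylor data
    of \<open>w\<close> at \<open>\<lambda> = 1\<close>.\<close>
  define a where "a = lc (\<lambda>j. poly (w j) 1)"
  define b where "b = lc (\<lambda>j. poly (pderiv (w j)) 1)"
  have F_left: "F (x * lc u) = (\<Sum>j<?n. u j * F (x * es ! j))"
    and F_right: "F (lc u * x) = (\<Sum>j<?n. u j * F (es ! j * x))" for x u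
    by (simp_all add: lc_def sum_distrib_left sum_distrib_right scale_mult_left scale_mult_right
        F.sum F.scale)

  have basis_ext: "f x = 0"
    if f: "Vector_Spaces.linear scale (*) f" and "\<And>i. i < ?n \<Longrightarrow> f (es ! i) = 0"
    for f :: "'a \<Rightarrow> complex" and x
  proof -
    interpret f: Vector_Spaces.linear scale "(*)" f by fact
    have "\<And>e. e \<in> set es \<Longrightarrow> f e = 0"
      using that(2) by (auto simp: in_set_conv_nth)
    then show ?thesis
      using f.eq_0_on_span[of "set es" x] basis by (auto simp: ordered_basis_def)
  qed

  have "F (x * a) - F (a * x) = 0" for x
  proof (rule basis_ext[where f = "\<lambda>x. F (x * a) - F (a * x)"])
    show "Vector_Spaces.linear scale (*) (\<lambda>x. F (x * a) - F (a * x))"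
      by unfold_locales
        (simp_all add: algebra_simps scale_mult_left scale_mult_right F.add F.scale)
    fix i assume "i < ?n"
    then have "poly (\<Sum>j<?n. ?M i j * w j) 1 = 0" using w by simp
    then show "F (es ! i * a) - F (a * es ! i) = 0"
      by (simp add: a_def F_left F_right poly_sum sum_subtractf algebra_simps)
  qed
  moreover have "F (x * a) + F (x * b) - F (b * x) = 0" for x
  proof (rule basis_ext[where f = "\<lambda>x. F (x * a) + F (x * b) - F (b * x)"])
    show "Vector_Spaces.linear scale (*) (\<lambda>x. F (x * a) + F (x * b) - F (b * x))"
      by unfold_locales
        (simp_all add: algebra_simps scale_mult_left scale_mult_right F.add F.scale)
    fix i assume "i < ?n"
    then have "poly (pderiv (\<Sum>j<?n. ?M i j * w j)) 1 = 0" using w by simp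
    then show "F (es ! i * a) + F (es ! i * b) - F (b * es ! i) = 0"
      by (simp add: a_def b_def F_left F_right higher_pderiv_sum[of 1, simplified] pderiv_diff
          pderiv_smult pderiv_pCons poly_sum
          sum.distrib sum_subtractf algebra_simps)
  qed
  ultimately have "a = 0"
    using assms(3) by (intro first_order_deformation_zero[of F a b]) (auto simp: F.add)

  moreover have "a \<noteq> 0"
  proof
    assume "a = 0"
    have inj: "inj_on ((!) es) {..<?n}" and img: "(!) es ` {..<?n} = set es"
      using basis by (auto simp: ordered_basis_def inj_on_def nth_eq_iff_index_eq set_conv_nth)
    \<comment> \<open>Linear independence takes coefficients indexed by vectors instead of positions in \<open>es\<close>.\<close>
    define c where "c e = poly (w (the_inv_into {..<?n} ((!) es) e)) 1" for e
    have c: "c (es ! j) = poly (w j) 1" if "j < ?n" for j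
      using the_inv_into_f_f[OF inj] that by (simp add: c_def)
    have "(\<Sum>e\<in>set es. scale (c e) e) = a"
      unfolding img[symmetric] sum.reindex[OF inj] a_def lc_def by (auto simp: c)
    then have "\<forall>e\<in>set es. c e = 0"
      using \<open>a = 0\<close> basis independentD[of "set es" "set es" c]
      by (auto simp: ordered_basis_def)
    then show False using nz c by (metis lessThan_iff nth_mem)
  qed
  ultimately show False by contradiction
qed

end
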